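(* Let $\mathbf{c}=(c_0,c_1,\dots,c_n)\in\mathfrak{C}_+(N)$. Then, for each $P\in\mathfrak{P}_+(N)$, there is a unique $Q\in\mathfrak{P}_+(N)$ such that $\Phi=P/Q$ satisfies the moment conditions $$\frac{1}{2N}\sum_{j=-N+1}^{N}\zeta_j^{k}\,\Phi(\zeta_j)=c_k,\qquad k=0,1,\dots,n.$$
   Context: Let $n<N$ be positive integers and $\zeta_j=e^{i\pi j/N}$, $j=-N+1,\dots,N$ (the $2N$-th roots of unity). Let $\mathfrak{P}$ be the finite-dimensional real vector space of symmetric trigonometric polynomials $P(\zeta)=\sum_{k=-n}^{n}p_k\zeta^{-k}$, with $p_k\in\mathbb{C}$, $p_{-k}=\overline{p_k}$ (so $P$ is real-valued on the unit circle). Put $$\mathfrak{P}_+(N)=\{P\in\mathfrak{P}: P(\zeta_j)>0,\ j=-N+1,\dots,N\},$$ and let $\overline{\mathfrak{P}_+(N)}$ be its closure in $\mathfrak{P}$. For $\mathbf{c}=(c_0,c_1,\dots,c_n)$ with $c_0$ real and $c_1,\dots,c_n$ complex, put $c_{-k}=\overline{c_k}$, $C(\zeta)=\sum_{k=-n}^n c_k\zeta^{-k}$ and, for $P\in\mathfrak{P}$, $\langle C,P\rangle=\sum_{k=-n}^{n}c_k\overline{p_k}$. The (open) dual cone is $$\mathfrak{C}_+(N)=\{\mathbf{c}: \langle C,P\rangle>0\ \text{for all } P\in\overline{\mathfrak{P}_+(N)}\setminus\{0\}\}.$$ *)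

theory Defs
  imports "HOL-Analysis.Analysis"
begin

definition zeta :: "nat \<Rightarrow> int \<Rightarrow> complex" where
  "zeta N j = exp (\<i> * of_real (pi * real_of_int j / real N))"

text \<open>
  A trigonometric polynomial of degree at most \<open>n\<close> is represented by its sequence of
  coefficients, a function on the integers that vanishes outside \<open>{-n..n}\<close>.
\<close>

definition sym_trig_polys :: "nat \<Rightarrow> (int \<Rightarrow> complex) set" where
  "sym_trig_polys n = {p. (\<forall>k. \<bar>k\<bar> > int n \<longrightarrow> p k = 0) \<and> (\<forall>k. p (- k) = cnj (p k))}"

definition trig_eval :: "nat \<Rightarrow> (int \<Rightarrow> complex) \<Rightarrow> complex \<Rightarrow> complex" where
  "trig_eval n p z = (\<Sum>k = - int n..int n. p k * z powi (- k))"

definition pairing :: "nat \<Rightarrow> (int \<Rightarrow> complex) \<Rightarrow> (int \<Rightarrow> complex) \<Rightarrow> complex" where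
  "pairing n c p = (\<Sum>k = - int n..int n. c k * cnj (p k))"

text \<open>
  Values of symmetric polynomials on the unit circle, and pairings of symmetric sequences, are
  real (lemmas \<open>trig_eval_real\<close> and \<open>pairing_real\<close> below), so nothing is lost by stating
  positivity through \<open>Re\<close>.
\<close>

definition pos_polys :: "nat \<Rightarrow> nat \<Rightarrow> (int \<Rightarrow> complex) set" where
  "pos_polys n N =
     {p \<in> sym_trig_polys n. \<forall>j\<in>{- int N + 1..int N}. Re (trig_eval n p (zeta N j)) > 0}"

text \<open>
  The type \<open>int \<Rightarrow> complex\<close> carries the topology of pointwise convergence, which on the
  finite-dimensional subspace \<open>sym_trig_polys n\<close> is the usual one.
\<close>

definition closed_pos_polys :: "nat \<Rightarrow> nat \<Rightarrow> (int \<Rightarrow> complex) set" where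
  "closed_pos_polys n N = top_of_set (sym_trig_polys n) closure_of pos_polys n N"

definition sym_extend :: "(nat \<Rightarrow> complex) \<Rightarrow> int \<Rightarrow> complex" where
  "sym_extend c k = (if k \<ge> 0 then c (nat k) else cnj (c (nat (- k))))"

text \<open>The tuple \<open>(c\<^sub>0, \<dots>, c\<^sub>n)\<close> is a sequence that vanishes beyond index \<open>n\<close>.\<close>

definition dual_cone :: "nat \<Rightarrow> nat \<Rightarrow> (nat \<Rightarrow> complex) set" where
  "dual_cone n N =
     {c. c 0 \<in> \<real> \<and> (\<forall>k>n. c k = 0) \<and>
         (\<forall>p \<in> closed_pos_polys n N - {\<lambda>_. 0}. Re (pairing n (sym_extend c) p) > 0)}"

lemma sum_symmetric_int:
  "(\<Sum>k = - int n..int n. f (- k)) = (\<Sum>k = - int n..int n. f k)"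
  by (rule sum.reindex_bij_witness[of _ uminus uminus]) auto

lemma trig_eval_real:
  assumes "p \<in> sym_trig_polys n" and "norm z = 1"
  shows "trig_eval n p z \<in> \<real>"
proof -
  have inv: "cnj z = inverse z"
    using assms(2) by (simp add: inverse_complex_def complex_eq_iff cmod_def)
  have pw: "cnj z powi (- m) = z powi m" for m :: int
    by (simp add: inv power_int_inverse power_int_minus)
  have "cnj (trig_eval n p z) = (\<Sum>k = - int n..int n. p (- k) * z powi (- (- k)))"
    using assms(1) by (simp add: trig_eval_def sym_trig_polys_def pw)
  also have "\<dots> = trig_eval n p z"
    unfolding trig_eval_def by (rule sum_symmetric_int)
  finally show ?thesis by (simp add: Reals_cnj_iff)
qed

lemma pairing_real:
  assumes "p \<in> sym_trig_polys n" and "c 0 \<in> \<real>"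
  shows "pairing n (sym_extend c) p \<in> \<real>"
proof -
  have "sym_extend c (- k) = cnj (sym_extend c k)" for k
    using assms(2) by (auto simp: sym_extend_def Reals_cnj_iff)
  then have "cnj (pairing n (sym_extend c) p) =
      (\<Sum>k = - int n..int n. sym_extend c (- k) * cnj (p (- k)))"
    using assms(1) by (simp add: pairing_def sym_trig_polys_def)
  also have "\<dots> = pairing n (sym_extend c) p"
    unfolding pairing_def by (rule sum_symmetric_int)
  finally show ?thesis by (simp add: Reals_cnj_iff)
qed

end

theory Submission
  imports Defs
begin

text \<open>
  Sampling at the grid points replaces a symmetric polynomial \<open>p\<close> by its real values
  \<open>p\<^sub>j = p(\<zeta>\<^sub>j)\<close>. Since \<open>n < N\<close>, orthogonality of the \<open>2N\<close>-th roots of unity recovers the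
  coefficients of \<open>p\<close> from these values (\<open>grid_moment_grid_value\<close>), and by
  \<open>pairing_grid_moment\<close> the moments of a real function \<open>\<phi>\<close> on the grid pair with \<open>p\<close> to
  \<open>(\<Sum>\<^sub>j \<phi>\<^sub>j p\<^sub>j) / 2N\<close>. So \<open>P/Q\<close> has the prescribed moments exactly if
  \<open>(\<Sum>\<^sub>j P\<^sub>j R\<^sub>j / Q\<^sub>j) / 2N = \<langle>C, R\<rangle>\<close> for every symmetric \<open>R\<close>.

  This is the equation for a critical point of the strictly convex functional
  \<open>\<langle>C, Q\<rangle> - (\<Sum>\<^sub>j P\<^sub>j log Q\<^sub>j) / 2N\<close>. Strict convexity gives uniqueness: two solutions \<open>Q\<close> and
  \<open>Q'\<close>, tested with \<open>R = Q' - Q\<close>, satisfy \<open>\<Sum>\<^sub>j P\<^sub>j (Q'\<^sub>j - Q\<^sub>j)\<^sup>2 / (Q\<^sub>j Q'\<^sub>j) = 0\<close>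
  (\<open>grid_moment_ratio_inj\<close>).

  For existence it is convenient to remove the scale of \<open>Q\<close>. Optimizing the functional along each
  ray leaves the problem of maximizing
  \<open>F(Q) = (\<Prod>\<^sub>j Q\<^sub>j powr P\<^sub>j) / \<langle>C, Q\<rangle> powr (\<Sum>\<^sub>j P\<^sub>j)\<close>,
  which is homogeneous of degree \<open>0\<close>. On the nonnegative polynomials with constant coefficient
  \<open>1\<close>, a compact set, the dual cone condition makes \<open>F\<close> continuous, and \<open>F\<close> vanishes as soon as
  some \<open>Q\<^sub>j\<close> does. So the maximum is attained at a polynomial positive on the grid
  (\<open>log_ratio_attains_max\<close>); the behaviour of the logarithm at the boundary never has to be
  estimated. The derivative of \<open>log F\<close> vanishes there (\<open>log_ratio_stationary\<close>), which is the
  equation above up to a factor, and rescaling \<open>Q\<close> removes the factor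
  (\<open>grid_moment_ratio_surj\<close>).
\<close>

section \<open>Discrete Fourier analysis on the grid\<close>

lemma zeta_powi: "zeta N j powi k = zeta N (j * k)"
  by (simp add: zeta_def exp_power_int algebra_simps)

lemma zeta_powi_commute: "zeta N j powi k = zeta N k powi j"
  by (simp add: zeta_powi mult.commute)

lemma zeta_nonzero [simp]: "zeta N j \<noteq> 0"
  by (simp add: zeta_def)

lemma norm_zeta [simp]: "norm (zeta N j) = 1"
  by (simp add: zeta_def)

lemma cnj_zeta_powi: "cnj (zeta N j powi k) = zeta N j powi (- k)"
  by (simp add: zeta_powi) (simp add: zeta_def exp_cnj)

lemma zeta_eq_1_iff:
  assumes "0 < N"
  shows "zeta N m = 1 \<longleftrightarrow> 2 * int N dvd m"
proof -
  have "zeta N m = 1 \<longleftrightarrow> (\<exists>r::int. pi * real_of_int m / real N = of_int (2 * r) * pi)"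
    unfolding zeta_def exp_eq_1 by simp
  also have "\<dots> \<longleftrightarrow> (\<exists>r::int. real_of_int m = real_of_int (2 * int N * r))"
    using assms by (auto simp: field_simps)
  also have "\<dots> \<longleftrightarrow> 2 * int N dvd m"
    unfolding of_int_eq_iff dvd_def ..
  finally show ?thesis .
qed

definition grid :: "nat \<Rightarrow> int set" where
  "grid N = {- int N + 1..int N}"

lemma finite_grid [simp]: "finite (grid N)"
  by (simp add: grid_def)

lemma card_grid [simp]: "card (grid N) = 2 * N"
  by (simp add: grid_def)

text \<open>
  Multiplication by \<open>w = \<zeta>\<^sub>m\<close> shifts the summation range of \<open>\<Sum>\<^sub>j w powi j\<close> by one, which does
  not change the sum because \<open>w\<close> is a \<open>2N\<close>-th root of unity; as \<open>w \<noteq> 1\<close>, the sum is \<open>0\<close>.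
\<close>

lemma sum_zeta_powi:
  assumes "0 < N" and "\<bar>m\<bar> < 2 * int N"
  shows "(\<Sum>j\<in>grid N. zeta N j powi m) = (if m = 0 then of_nat (2 * N) else 0)"
proof (cases "m = 0")
  case False
  define w where "w = zeta N m"
  have "w \<noteq> 1"
    using False assms zdvd_imp_le[of "2 * int N" "\<bar>m\<bar>"] by (auto simp: w_def zeta_eq_1_iff)
  have [simp]: "w \<noteq> 0"
    by (simp add: w_def)
  have period: "w powi (int N + 1) = w powi (- int N + 1)"
  proof -
    have "w powi (2 * int N) = 1"
      using assms(1) by (simp add: w_def zeta_powi zeta_eq_1_iff)
    moreover have "w powi (int N + 1) = w powi (2 * int N) * w powi (- int N + 1)"
      by (simp flip: power_int_add)
    ultimately show ?thesis by simp
  qed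
  have "w * (\<Sum>j\<in>grid N. w powi j) = (\<Sum>j\<in>grid N. w powi (j + 1))"
    by (simp add: sum_distrib_left power_int_add mult.commute)
  also have "\<dots> = (\<Sum>j\<in>{- int N + 2..int N + 1}. w powi j)"
    unfolding grid_def
    by (rule sum.reindex_bij_witness[of _ "\<lambda>j. j - 1" "\<lambda>j. j + 1"]) auto
  also have "{- int N + 2..int N + 1} = insert (int N + 1) {- int N + 2..int N}"
    using assms(1) by auto
  also have "(\<Sum>j\<in>\<dots>. w powi j) = (\<Sum>j\<in>insert (- int N + 1) {- int N + 2..int N}. w powi j)"
    by (simp add: period)
  also have "insert (- int N + 1) {- int N + 2..int N} = grid N"
    using assms(1) by (auto simp: grid_def)
  finally have "(w - 1) * (\<Sum>j\<in>grid N. w powi j) = 0"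
    by (simp add: algebra_simps)
  with \<open>w \<noteq> 1\<close> have "(\<Sum>j\<in>grid N. w powi j) = 0"
    by simp
  with False show ?thesis
    by (simp add: w_def zeta_powi_commute[of N _ m])
qed simp

definition grid_value :: "nat \<Rightarrow> nat \<Rightarrow> (int \<Rightarrow> complex) \<Rightarrow> int \<Rightarrow> real" where
  "grid_value n N p j = Re (trig_eval n p (zeta N j))"

text \<open>
  These are discrete Fourier coefficients; the positive exponent of \<open>\<zeta>\<^sub>j\<close> matches the negative
  one in \<^const>\<open>trig_eval\<close>.
\<close>

definition grid_moment :: "nat \<Rightarrow> (int \<Rightarrow> real) \<Rightarrow> int \<Rightarrow> complex" where
  "grid_moment N \<phi> k = (\<Sum>j\<in>grid N. zeta N j powi k * of_real (\<phi> j)) / of_nat (2 * N)"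

lemma trig_eval_zeta:
  "p \<in> sym_trig_polys n \<Longrightarrow> trig_eval n p (zeta N j) = of_real (grid_value n N p j)"
  unfolding grid_value_def by (simp add: trig_eval_real)

text \<open>
  Fourier inversion: the exponents \<open>m - k\<close> that occur have modulus at most \<open>2n < 2N\<close>, so
  the roots of unity cannot alias two of them.
\<close>

lemma grid_moment_grid_value:
  assumes "n < N" and "p \<in> sym_trig_polys n" and "\<bar>m\<bar> \<le> int n"
  shows "grid_moment N (grid_value n N p) m = p m"
proof -
  have "(\<Sum>j\<in>grid N. zeta N j powi m * of_real (grid_value n N p j))
      = (\<Sum>j\<in>grid N. \<Sum>k = - int n..int n. p k * zeta N j powi (m - k))"
    using assms(2)
    by (simp add: trig_eval_zeta[symmetric])
      (simp add: trig_eval_def sum_distrib_left power_int_diff power_int_minus divide_inverse mult_ac)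
  also have "\<dots> = (\<Sum>k = - int n..int n. p k * (\<Sum>j\<in>grid N. zeta N j powi (m - k)))"
    by (subst sum.swap) (simp add: sum_distrib_left)
  also have "\<dots> = (\<Sum>k = - int n..int n. if m = k then of_nat (2 * N) * p k else 0)"
    using assms by (intro sum.cong refl) (subst sum_zeta_powi, auto)
  also have "\<dots> = of_nat (2 * N) * p m"
    using assms(3) by (subst sum.delta') auto
  finally show ?thesis
    using assms(1) by (simp add: grid_moment_def)
qed

text \<open>
  Taking moments is adjoint to sampling. This turns conditions on coefficients into weighted sums
  over the grid, where positivity can be used.
\<close>

lemma pairing_grid_moment:
  assumes "p \<in> sym_trig_polys n"
  shows "pairing n (grid_moment N \<phi>) p
    = of_real ((\<Sum>j\<in>grid N. \<phi> j * grid_value n N p j) / real (2 * N))"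
proof -
  have value_cnj: "of_real (grid_value n N p j) = (\<Sum>k = - int n..int n. zeta N j powi k * cnj (p k))"
    for j
  proof -
    have "of_real (grid_value n N p j) = cnj (trig_eval n p (zeta N j))"
      using assms by (simp add: trig_eval_zeta)
    also have "\<dots> = (\<Sum>k = - int n..int n. zeta N j powi k * cnj (p k))"
      unfolding trig_eval_def cnj_sum complex_cnj_mult cnj_zeta_powi by (simp add: mult.commute)
    finally show ?thesis .
  qed
  have "pairing n (grid_moment N \<phi>) p
      = (\<Sum>k = - int n..int n. \<Sum>j\<in>grid N. of_real (\<phi> j) * (zeta N j powi k * cnj (p k)))
          / of_nat (2 * N)"
    by (simp add: pairing_def grid_moment_def sum_distrib_left sum_distrib_right sum_divide_distrib mult_ac)
  also have "(\<Sum>k = - int n..int n. \<Sum>j\<in>grid N. of_real (\<phi> j) * (zeta N j powi k * cnj (p k)))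
      = (\<Sum>j\<in>grid N. of_real (\<phi> j) * of_real (grid_value n N p j))"
    by (subst sum.swap) (simp add: sum_distrib_left value_cnj)
  finally show ?thesis
    by simp
qed

lemma grid_moment_uminus: "grid_moment N \<phi> (- k) = cnj (grid_moment N \<phi> k)"
  unfolding grid_moment_def complex_cnj_divide cnj_sum complex_cnj_mult cnj_zeta_powi by simp

lemma sym_trig_polys_eqI:
  assumes "n < N" and "p \<in> sym_trig_polys n" and "q \<in> sym_trig_polys n"
    and "\<And>j. j \<in> grid N \<Longrightarrow> grid_value n N p j = grid_value n N q j"
  shows "p = q"
proof
  fix k
  show "p k = q k"
  proof (cases "\<bar>k\<bar> \<le> int n")
    case True
    have "grid_moment N (grid_value n N p) k = grid_moment N (grid_value n N q) k"
      using assms(4) by (simp add: grid_moment_def)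
    with True assms show ?thesis
      by (simp add: grid_moment_grid_value)
  next
    case False
    with assms show ?thesis by (simp add: sym_trig_polys_def)
  qed
qed

section \<open>Real-linear structure\<close>

lemma sym_trig_polys_comb:
  assumes "p \<in> sym_trig_polys n" and "q \<in> sym_trig_polys n"
  shows "(\<lambda>k. of_real s * p k + of_real t * q k) \<in> sym_trig_polys n"
  using assms by (simp add: sym_trig_polys_def)

lemma sym_trig_polys_scale:
  "p \<in> sym_trig_polys n \<Longrightarrow> (\<lambda>k. of_real s * p k) \<in> sym_trig_polys n"
  by (simp add: sym_trig_polys_def)

lemma grid_value_comb:
  "grid_value n N (\<lambda>k. of_real s * p k + of_real t * q k) j
    = s * grid_value n N p j + t * grid_value n N q j"
proof -
  have "trig_eval n (\<lambda>k. of_real s * p k + of_real t * q k) z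
      = of_real s * trig_eval n p z + of_real t * trig_eval n q z" for z
    by (simp add: trig_eval_def sum_distrib_left sum.distrib algebra_simps)
  then show ?thesis by (simp add: grid_value_def)
qed

lemma grid_value_scale:
  "grid_value n N (\<lambda>k. of_real s * p k) j = s * grid_value n N p j"
  using grid_value_comb[of n N s p 0 p j] by simp

lemma Re_pairing_comb:
  "Re (pairing n d (\<lambda>k. of_real s * p k + of_real t * q k))
    = s * Re (pairing n d p) + t * Re (pairing n d q)"
proof -
  have "pairing n d (\<lambda>k. of_real s * p k + of_real t * q k)
      = of_real s * pairing n d p + of_real t * pairing n d q"
    by (simp add: pairing_def sum_distrib_left sum.distrib algebra_simps)
  then show ?thesis by simp
qed

lemma Re_pairing_scale:
  "Re (pairing n d (\<lambda>k. of_real s * p k)) = s * Re (pairing n d p)"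
  using Re_pairing_comb[of n d s p 0 p] by simp

lemma pos_polys_iff:
  "p \<in> pos_polys n N \<longleftrightarrow> p \<in> sym_trig_polys n \<and> (\<forall>j\<in>grid N. 0 < grid_value n N p j)"
  by (simp add: pos_polys_def grid_def grid_value_def)

definition one_poly :: "int \<Rightarrow> complex" where
  "one_poly k = (if k = 0 then 1 else 0)"

lemma one_poly_sym: "one_poly \<in> sym_trig_polys n"
  by (simp add: one_poly_def sym_trig_polys_def)

lemma grid_value_one_poly [simp]: "grid_value n N one_poly j = 1"
proof -
  have "trig_eval n one_poly (zeta N j) = (\<Sum>k = - int n..int n. if k = 0 then 1 else 0)"
    unfolding trig_eval_def by (intro sum.cong) (auto simp: one_poly_def)
  then show ?thesis by (simp add: grid_value_def)
qed

section \<open>The cone of nonnegative polynomials\<close>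

definition nonneg_polys :: "nat \<Rightarrow> nat \<Rightarrow> (int \<Rightarrow> complex) set" where
  "nonneg_polys n N = {p \<in> sym_trig_polys n. \<forall>j\<in>grid N. 0 \<le> grid_value n N p j}"

lemma pos_polys_subset_nonneg: "pos_polys n N \<subseteq> nonneg_polys n N"
  by (auto simp: pos_polys_iff nonneg_polys_def less_imp_le)

text \<open>
  For nonnegative \<open>p\<close>, the polynomials \<open>p + t\<close> with \<open>t > 0\<close> are positive and tend to \<open>p\<close>.
  Hence the dual cone condition applies to every nonzero nonnegative polynomial.
\<close>

lemma nonneg_subset_closed_pos_polys: "nonneg_polys n N \<subseteq> closed_pos_polys n N"
proof
  fix p assume p: "p \<in> nonneg_polys n N"
  define f :: "real \<Rightarrow> int \<Rightarrow> complex"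
    where "f t = (\<lambda>k. of_real 1 * p k + of_real t * one_poly k)" for t
  have "continuous_on UNIV f"
    unfolding f_def by (intro continuous_intros)
  moreover have "f ` {0<..} \<subseteq> closure (pos_polys n N)"
  proof -
    have "f t \<in> pos_polys n N" if "0 < t" for t
      using p that unfolding f_def pos_polys_iff nonneg_polys_def
      by (auto simp: grid_value_comb intro!: sym_trig_polys_comb one_poly_sym add_nonneg_pos
          simp del: of_real_1 mult_1)
    then show ?thesis using closure_subset by blast
  qed
  ultimately have "f ` closure {0<..} \<subseteq> closure (pos_polys n N)"
    by (intro image_closure_subset) (auto intro: continuous_on_subset)
  moreover have "(0::real) \<in> closure {0<..}"
    by simp
  moreover have "f 0 = p"
    by (simp add: f_def)
  ultimately have "p \<in> closure (pos_polys n N)"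
    by (metis image_subset_iff)
  moreover have "pos_polys n N \<subseteq> sym_trig_polys n"
    by (auto simp: pos_polys_iff)
  ultimately show "p \<in> closed_pos_polys n N"
    using p
    by (simp add: closed_pos_polys_def closure_of_subtopology nonneg_polys_def Int_absorb1)
qed

lemma nonneg_polys_coeff_0:
  assumes "n < N" and "p \<in> sym_trig_polys n"
  shows "p 0 = of_real ((\<Sum>j\<in>grid N. grid_value n N p j) / real (2 * N))"
  using grid_moment_grid_value[OF assms, of 0] by (simp add: grid_moment_def)

text \<open>
  By Fourier inversion every coefficient is a mean of the values multiplied by unimodular numbers, and the
  constant coefficient is the plain mean. This bound makes the normalized slice of the cone compact.
\<close>

lemma norm_coeff_le:
  assumes "n < N" and "p \<in> nonneg_polys n N"
  shows "norm (p k) \<le> Re (p 0)"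
proof (cases "\<bar>k\<bar> \<le> int n")
  case True
  from assms(2) have sym: "p \<in> sym_trig_polys n"
    and nonneg: "\<And>j. j \<in> grid N \<Longrightarrow> 0 \<le> grid_value n N p j"
    by (auto simp: nonneg_polys_def)
  have "norm (p k) = norm (\<Sum>j\<in>grid N. zeta N j powi k * of_real (grid_value n N p j)) / real (2 * N)"
    unfolding grid_moment_grid_value[OF assms(1) sym True, symmetric] grid_moment_def norm_divide norm_of_nat ..
  also have "\<dots> \<le> (\<Sum>j\<in>grid N. grid_value n N p j) / real (2 * N)"
    by (intro divide_right_mono sum_norm_le) (auto simp: norm_mult norm_power_int nonneg)
  also have "\<dots> = Re (p 0)"
    using nonneg_polys_coeff_0[OF assms(1) sym] by simp
  finally show ?thesis .
next
  case False
  with assms have "norm (p k) = 0" and "0 \<le> Re (p 0)"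
    by (auto simp: nonneg_polys_def sym_trig_polys_def nonneg_polys_coeff_0[of n N p]
        intro!: sum_nonneg divide_nonneg_nonneg)
  then show ?thesis by simp
qed

definition normalized_nonneg_polys :: "nat \<Rightarrow> nat \<Rightarrow> (int \<Rightarrow> complex) set" where
  "normalized_nonneg_polys n N = {p \<in> nonneg_polys n N. p 0 = 1}"

lemma continuous_on_grid_value: "continuous_on A (\<lambda>p. grid_value n N p j)"
  unfolding grid_value_def trig_eval_def
  by (intro continuous_intros continuous_on_subset[OF continuous_on_product_coordinates]) auto

lemma continuous_on_Re_pairing: "continuous_on A (\<lambda>p. Re (pairing n d p))"
  unfolding pairing_def
  by (intro continuous_intros continuous_on_subset[OF continuous_on_product_coordinates]) auto

text \<open>
  The slice is a closed subset of a product of closed unit discs, so Tychonoff's theorem applies.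
\<close>

lemma compact_normalized_nonneg_polys:
  assumes "n < N"
  shows "compact (normalized_nonneg_polys n N)"
proof -
  have "compact (PiE UNIV (\<lambda>_::int. cball (0::complex) 1))"
    using compactin_PiE[of "\<lambda>_::int. euclidean :: complex topology" UNIV "\<lambda>_. cball 0 1"]
    by (simp add: euclidean_product_topology)
  moreover have "closed (normalized_nonneg_polys n N)"
    unfolding normalized_nonneg_polys_def nonneg_polys_def sym_trig_polys_def Ball_def mem_Collect_eq
    by (intro closed_Collect_conj closed_Collect_all closed_Collect_imp closed_Collect_eq
        closed_Collect_le open_Collect_const continuous_on_grid_value continuous_intros
        continuous_on_product_coordinates)
  moreover have "normalized_nonneg_polys n N \<subseteq> PiE UNIV (\<lambda>_. cball 0 1)"
    using norm_coeff_le[OF assms] by (fastforce simp: normalized_nonneg_polys_def)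
  ultimately show ?thesis
    using compact_Int_closed[of "PiE UNIV (\<lambda>_. cball 0 1)" "normalized_nonneg_polys n N"]
    by (simp add: Int_absorb1)
qed

section \<open>Maximizing the homogeneous functional\<close>

text \<open>
  The logarithm of \<open>(\<Prod>\<^sub>j p\<^sub>j powr a\<^sub>j) / (Re \<langle>d, p\<rangle>) powr (\<Sum>\<^sub>j a\<^sub>j)\<close>, meaningful where \<open>p\<close> is
  positive on the grid and the pairing is positive.
\<close>

definition log_ratio ::
  "nat \<Rightarrow> nat \<Rightarrow> (int \<Rightarrow> real) \<Rightarrow> (int \<Rightarrow> complex) \<Rightarrow> (int \<Rightarrow> complex) \<Rightarrow> real" where
  "log_ratio n N a d p =
     (\<Sum>j\<in>grid N. a j * ln (grid_value n N p j)) - (\<Sum>j\<in>grid N. a j) * ln (Re (pairing n d p))"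

lemma log_ratio_scale:
  assumes "0 < s" and "p \<in> pos_polys n N" and "0 < Re (pairing n d p)"
  shows "log_ratio n N a d (\<lambda>k. of_real s * p k) = log_ratio n N a d p"
proof -
  have "(\<Sum>j\<in>grid N. a j * ln (s * grid_value n N p j))
      = (\<Sum>j\<in>grid N. a j * ln s + a j * ln (grid_value n N p j))"
    using assms
    by (intro sum.cong refl) (auto simp: pos_polys_iff ln_mult algebra_simps dest!: bspec)
  with assms show ?thesis
    by (simp add: log_ratio_def grid_value_scale Re_pairing_scale ln_mult sum.distrib
        algebra_simps flip: sum_distrib_left)
qed

text \<open>
  The maximum is taken for the exponential \<open>F\<close> of the functional, which extends continuously by
  \<open>0\<close> to the polynomials with zeros on the grid. It is positive at the constant polynomial \<open>1\<close>,
  hence at the maximizer, which therefore has no zero on the grid. Homogeneity carries the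
  maximality from the slice \<open>p 0 = 1\<close> to all positive polynomials.
\<close>

lemma log_ratio_attains_max:
  assumes "n < N"
    and a_pos: "\<And>j. j \<in> grid N \<Longrightarrow> 0 < a j"
    and d_pos: "\<And>p. p \<in> nonneg_polys n N \<Longrightarrow> p \<noteq> (\<lambda>_. 0) \<Longrightarrow> 0 < Re (pairing n d p)"
  obtains Q where "Q \<in> pos_polys n N"
    and "\<And>p. p \<in> pos_polys n N \<Longrightarrow> log_ratio n N a d p \<le> log_ratio n N a d Q"
proof -
  let ?B = "normalized_nonneg_polys n N"
  define F where "F p = (\<Prod>j\<in>grid N. grid_value n N p j powr a j)
      / Re (pairing n d p) powr (\<Sum>j\<in>grid N. a j)" for p
  have B_pairing: "0 < Re (pairing n d p)" if "p \<in> ?B" for p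
    using that by (intro d_pos) (auto simp: normalized_nonneg_polys_def)
  have F_exp: "F p = exp (log_ratio n N a d p)" if "p \<in> pos_polys n N" "0 < Re (pairing n d p)" for p
  proof -
    have "(\<Prod>j\<in>grid N. grid_value n N p j powr a j)
        = exp (\<Sum>j\<in>grid N. a j * ln (grid_value n N p j))"
      unfolding exp_sum[OF finite_grid] using that
      by (intro prod.cong refl) (auto simp: powr_def pos_polys_iff dest!: bspec)
    with that show ?thesis
      by (simp add: F_def log_ratio_def exp_diff powr_def)
  qed
  have one_B: "one_poly \<in> ?B"
    by (simp add: normalized_nonneg_polys_def nonneg_polys_def one_poly_sym) (simp add: one_poly_def)
  have one_pos: "one_poly \<in> pos_polys n N"
    by (simp add: pos_polys_iff one_poly_sym)
  have "continuous_on ?B F"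
    unfolding F_def
  proof (intro continuous_on_divide continuous_on_prod continuous_on_powr'
      continuous_on_grid_value continuous_on_Re_pairing continuous_on_const ballI conjI impI)
    fix p j assume "p \<in> ?B" "j \<in> grid N"
    then show "0 \<le> grid_value n N p j" and "0 < a j"
      by (auto simp: normalized_nonneg_polys_def nonneg_polys_def a_pos)
  next
    fix p assume p: "p \<in> ?B"
    from B_pairing[OF p] show "0 \<le> Re (pairing n d p)"
      and "Re (pairing n d p) powr (\<Sum>j\<in>grid N. a j) \<noteq> 0" by auto
    assume "Re (pairing n d p) = 0"
    with B_pairing[OF p] show "0 < (\<Sum>j\<in>grid N. a j)" by simp
  qed
  then obtain Q where Q: "Q \<in> ?B" and max: "\<And>p. p \<in> ?B \<Longrightarrow> F p \<le> F Q"
    using continuous_attains_sup[OF compact_normalized_nonneg_polys[OF assms(1)]] one_B by blast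
  have "0 < F one_poly"
    using F_exp[OF one_pos B_pairing[OF one_B]] by simp
  also have "F one_poly \<le> F Q"
    by (rule max[OF one_B])
  finally have "F Q \<noteq> 0" by simp
  then have "grid_value n N Q j \<noteq> 0" if "j \<in> grid N" for j
    using that by (auto simp: F_def)
  with Q have Q_pos: "Q \<in> pos_polys n N"
    by (auto simp: pos_polys_iff normalized_nonneg_polys_def nonneg_polys_def order_less_le)
  show ?thesis
  proof (rule that[OF Q_pos])
    fix p assume p: "p \<in> pos_polys n N"
    \<comment> \<open>The constant coefficient of \<open>p\<close>, as a real number.\<close>
    define s where "s = (\<Sum>j\<in>grid N. grid_value n N p j) / real (2 * N)"
    have "0 < s"
      using p assms(1) unfolding s_def
      by (intro divide_pos_pos sum_pos) (auto simp: pos_polys_iff grid_def)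
    have p0: "p 0 = of_real s"
      using p assms(1) unfolding s_def by (intro nonneg_polys_coeff_0) (auto simp: pos_polys_iff)
    let ?q = "\<lambda>k. of_real (1 / s) * p k"
    have q_pos: "?q \<in> pos_polys n N"
      using p \<open>0 < s\<close> sym_trig_polys_scale[of p n "1 / s"] grid_value_scale[of n N "1 / s" p]
      by (auto simp: pos_polys_iff)
    have "?q 0 = 1"
      using \<open>0 < s\<close> by (simp add: p0)
    with q_pos have q_B: "?q \<in> ?B"
      using pos_polys_subset_nonneg unfolding normalized_nonneg_polys_def by blast
    have p_pairing: "0 < Re (pairing n d p)"
      using p p0 \<open>0 < s\<close> pos_polys_subset_nonneg by (intro d_pos) auto
    have "log_ratio n N a d p = log_ratio n N a d ?q"
      using \<open>0 < s\<close> p p_pairing by (intro log_ratio_scale[symmetric]) auto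
    also have "\<dots> \<le> log_ratio n N a d Q"
      using max[OF q_B]
      by (simp only: F_exp[OF q_pos B_pairing[OF q_B]] F_exp[OF Q_pos B_pairing[OF Q]] exp_le_cancel_iff)
    finally show "log_ratio n N a d p \<le> log_ratio n N a d Q" .
  qed
qed

text \<open>
  The positive polynomials form an open set, so \<open>t \<mapsto> log_ratio (Q + t R)\<close> is defined near
  \<open>0\<close> and has a local maximum there; the identity says that its derivative is \<open>0\<close>.
\<close>

lemma log_ratio_stationary:
  assumes "0 < N"
    and Q: "Q \<in> pos_polys n N" and Q_pairing: "0 < Re (pairing n d Q)"
    and max: "\<And>p. p \<in> pos_polys n N \<Longrightarrow> log_ratio n N a d p \<le> log_ratio n N a d Q"
    and R: "R \<in> sym_trig_polys n"
  shows "(\<Sum>j\<in>grid N. a j * grid_value n N R j / grid_value n N Q j)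
    = (\<Sum>j\<in>grid N. a j) * Re (pairing n d R) / Re (pairing n d Q)"
proof -
  let ?q = "grid_value n N Q" and ?r = "grid_value n N R"
  let ?L = "\<lambda>p. Re (pairing n d p)"
  let ?p = "\<lambda>t::real. \<lambda>k. of_real 1 * Q k + of_real t * R k"
  define g where "g t = log_ratio n N a d (?p t)" for t
  define D where "D = (\<Sum>j\<in>grid N. a j * (?r j / ?q j)) - (\<Sum>j\<in>grid N. a j) * (?L R / ?L Q)"
  have q_pos: "0 < ?q j" if "j \<in> grid N" for j
    using Q that by (simp add: pos_polys_iff)
  have g_eq: "g = (\<lambda>t. (\<Sum>j\<in>grid N. a j * ln (?q j + t * ?r j)) - (\<Sum>j\<in>grid N. a j) * ln (?L Q + t * ?L R))"
    unfolding g_def log_ratio_def grid_value_comb Re_pairing_comb by simp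
  have "DERIV g 0 :> D"
    unfolding g_eq D_def
    by (rule derivative_eq_intros refl | use q_pos Q_pairing in \<open>force simp: field_simps\<close>)+
  moreover obtain \<epsilon> where "0 < \<epsilon>" and near: "\<And>t. \<bar>t\<bar> < \<epsilon> \<Longrightarrow> ?p t \<in> pos_polys n N"
  proof -
    have "\<forall>\<^sub>F t in nhds 0. \<forall>j\<in>grid N. 0 < ?q j + t * ?r j"
    proof (intro eventually_ball_finite finite_grid ballI)
      fix j assume "j \<in> grid N"
      have "((\<lambda>t. ?q j + t * ?r j) \<longlongrightarrow> ?q j + 0 * ?r j) (nhds 0)"
        by (intro tendsto_intros filterlim_ident)
      with q_pos[OF \<open>j \<in> grid N\<close>] show "\<forall>\<^sub>F t in nhds 0. 0 < ?q j + t * ?r j"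
        by (intro order_tendstoD(1)) auto
    qed
    then obtain \<epsilon> where "0 < \<epsilon>"
      and \<epsilon>: "\<And>t j. \<bar>t\<bar> < \<epsilon> \<Longrightarrow> j \<in> grid N \<Longrightarrow> 0 < ?q j + t * ?r j"
      unfolding eventually_nhds_metric by (auto simp: dist_real_def)
    have "?p t \<in> pos_polys n N" if "\<bar>t\<bar> < \<epsilon>" for t
      unfolding pos_polys_iff grid_value_comb
      using Q R \<epsilon>[OF that] sym_trig_polys_comb[of Q n R 1 t] by (auto simp: pos_polys_iff)
    with \<open>0 < \<epsilon>\<close> show ?thesis by (rule that)
  qed
  moreover have "g t \<le> g 0" if "\<bar>0 - t\<bar> < \<epsilon>" for t
    using max[OF near] that by (simp add: g_def)
  ultimately have "D = 0"
    using DERIV_local_max[of g D 0 \<epsilon>] by blast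
  then show ?thesis
    by (simp add: D_def)
qed

section \<open>Existence and uniqueness\<close>

lemma sym_extend_uminus:
  "c 0 \<in> \<real> \<Longrightarrow> sym_extend c (- k) = cnj (sym_extend c k)"
  by (auto simp: sym_extend_def Reals_cnj_iff)

text \<open>
  The difference of \<open>d\<close> and \<open>e\<close>, cut off beyond \<open>n\<close>, is itself a symmetric polynomial; tested with
  it, the hypothesis says that the sum of the squared moduli of the differences is \<open>0\<close>.
\<close>

lemma pairing_eq_imp_coeff_eq:
  assumes "\<And>k. d (- k) = cnj (d k)" and "\<And>k. e (- k) = cnj (e k)"
    and eq: "\<And>r. r \<in> sym_trig_polys n \<Longrightarrow> Re (pairing n d r) = Re (pairing n e r)"
    and "\<bar>m\<bar> \<le> int n"
  shows "d m = e m"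
proof -
  define r where "r k = (if \<bar>k\<bar> \<le> int n then d k - e k else 0)" for k
  have "r \<in> sym_trig_polys n"
    using assms(1,2) by (auto simp: r_def sym_trig_polys_def)
  from eq[OF this] have "0 = Re (pairing n d r - pairing n e r)"
    by simp
  also have "pairing n d r - pairing n e r = (\<Sum>k = - int n..int n. (d k - e k) * cnj (r k))"
    by (simp add: pairing_def sum_subtractf algebra_simps)
  also have "\<dots> = (\<Sum>k = - int n..int n. of_real ((norm (r k))\<^sup>2))"
    by (intro sum.cong refl) (simp add: r_def complex_norm_square[symmetric] del: complex_cnj_diff)
  finally have "(\<Sum>k = - int n..int n. (norm (r k))\<^sup>2) = 0"
    by simp
  then have "(norm (r m))\<^sup>2 = 0"
    using assms(4) by (subst (asm) sum_nonneg_eq_0_iff) (auto simp: abs_le_iff)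
  with assms(4) show ?thesis
    by (simp add: r_def)
qed

text \<open>
  The moments of a real function are symmetric, so the conditions with \<open>k \<ge> 0\<close> imply those
  with \<open>k < 0\<close>.
\<close>

lemma moment_condition_iff:
  assumes "P \<in> sym_trig_polys n" and "Q \<in> sym_trig_polys n" and "c 0 \<in> \<real>"
  shows "(\<forall>k\<in>{0..n}. 1 / (2 * of_nat N) * (\<Sum>j = - int N + 1..int N.
          zeta N j ^ k * (trig_eval n P (zeta N j) / trig_eval n Q (zeta N j))) = c k)
    \<longleftrightarrow> (\<forall>k. \<bar>k\<bar> \<le> int n \<longrightarrow>
          grid_moment N (\<lambda>j. grid_value n N P j / grid_value n N Q j) k = sym_extend c k)"
    (is "?A \<longleftrightarrow> (\<forall>k. _ \<longrightarrow> ?m k = _)")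
proof -
  have "?A \<longleftrightarrow> (\<forall>k\<in>{0..n}. ?m (int k) = c k)"
    using assms by (simp add: trig_eval_zeta grid_moment_def grid_def)
  also have "\<dots> \<longleftrightarrow> (\<forall>k. \<bar>k\<bar> \<le> int n \<longrightarrow> ?m k = sym_extend c k)"
  proof safe
    fix k :: int
    assume *: "\<forall>k\<in>{0..n}. ?m (int k) = c k" and k: "\<bar>k\<bar> \<le> int n"
    have abs: "?m \<bar>k\<bar> = sym_extend c \<bar>k\<bar>"
      using *[rule_format, of "nat \<bar>k\<bar>"] k by (simp add: sym_extend_def)
    show "?m k = sym_extend c k"
    proof (cases "k \<ge> 0")
      case False
      then have "k = - \<bar>k\<bar>" by simp
      then show ?thesis
        using abs grid_moment_uminus sym_extend_uminus[of c, OF assms(3)] by metis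
    qed (use abs in simp)
  next
    fix k assume "\<forall>k. \<bar>k\<bar> \<le> int n \<longrightarrow> ?m k = sym_extend c k" and "k \<in> {0..n}"
    from this(1)[rule_format, of "int k"] this(2) show "?m (int k) = c k"
      by (simp add: sym_extend_def)
  qed
  finally show ?thesis .
qed

text \<open>
  The map \<open>x \<mapsto> a / x\<close> is strictly decreasing for \<open>a > 0\<close>: pairing the difference of the two
  moment sequences with \<open>Q' - Q\<close> gives a sum of nonnegative terms, each of which must vanish.
\<close>

lemma grid_moment_ratio_inj:
  assumes "n < N" and P: "P \<in> pos_polys n N" and Q: "Q \<in> pos_polys n N" and Q': "Q' \<in> pos_polys n N"
    and eq: "\<And>k. \<bar>k\<bar> \<le> int n \<Longrightarrow>
      grid_moment N (\<lambda>j. grid_value n N P j / grid_value n N Q j) k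
      = grid_moment N (\<lambda>j. grid_value n N P j / grid_value n N Q' j) k"
  shows "Q = Q'"
proof -
  let ?a = "grid_value n N P" and ?q = "grid_value n N Q" and ?q' = "grid_value n N Q'"
  define R where "R = (\<lambda>k. of_real 1 * Q' k + of_real (- 1) * Q k)"
  have R: "R \<in> sym_trig_polys n"
    unfolding R_def using Q Q' by (intro sym_trig_polys_comb) (auto simp: pos_polys_iff)
  have R_value: "grid_value n N R j = ?q' j - ?q j" for j
    unfolding R_def grid_value_comb by simp
  have "pairing n (grid_moment N (\<lambda>j. ?a j / ?q j)) R = pairing n (grid_moment N (\<lambda>j. ?a j / ?q' j)) R"
    unfolding pairing_def by (intro sum.cong refl arg_cong2[of _ _ _ _ "(*)"] eq) auto
  then have "(\<Sum>j\<in>grid N. ?a j / ?q j * (?q' j - ?q j)) - (\<Sum>j\<in>grid N. ?a j / ?q' j * (?q' j - ?q j)) = 0"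
    using assms(1) unfolding pairing_grid_moment[OF R] R_value of_real_eq_iff by simp
  also have "(\<Sum>j\<in>grid N. ?a j / ?q j * (?q' j - ?q j)) - (\<Sum>j\<in>grid N. ?a j / ?q' j * (?q' j - ?q j))
      = (\<Sum>j\<in>grid N. ?a j * (?q' j - ?q j)\<^sup>2 / (?q j * ?q' j))"
    unfolding sum_subtractf[symmetric]
  proof (intro sum.cong refl)
    fix j assume "j \<in> grid N"
    then have "?q j \<noteq> 0" "?q' j \<noteq> 0"
      using Q Q' by (auto simp: pos_polys_iff dest!: bspec)
    then show "?a j / ?q j * (?q' j - ?q j) - ?a j / ?q' j * (?q' j - ?q j)
        = ?a j * (?q' j - ?q j)\<^sup>2 / (?q j * ?q' j)"
      by (simp add: field_simps power2_eq_square)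
  qed
  finally have sum_0: "(\<Sum>j\<in>grid N. ?a j * (?q' j - ?q j)\<^sup>2 / (?q j * ?q' j)) = 0" .
  have "?q j = ?q' j" if j: "j \<in> grid N" for j
  proof -
    have pos: "0 < ?a i" "0 < ?q i" "0 < ?q' i" if "i \<in> grid N" for i
      using P Q Q' that by (auto simp: pos_polys_iff)
    have "?a j * (?q' j - ?q j)\<^sup>2 / (?q j * ?q' j) = 0"
      using sum_0 j pos by (subst (asm) sum_nonneg_eq_0_iff) (auto simp: less_imp_le)
    with pos[OF j] show ?thesis by simp
  qed
  with assms(1) Q Q' show ?thesis
    by (intro sym_trig_polys_eqI[of n N]) (auto simp: pos_polys_iff)
qed

text \<open>
  A maximizer \<open>Q\<^sub>0\<close> of the homogeneous functional solves the moment equations up to a positive factor,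
  and a positive multiple of \<open>Q\<^sub>0\<close> is still positive on the grid.
\<close>

lemma grid_moment_ratio_surj:
  assumes "n < N" and P: "P \<in> pos_polys n N" and sym: "\<And>k. d (- k) = cnj (d k)"
    and d_pos: "\<And>p. p \<in> nonneg_polys n N \<Longrightarrow> p \<noteq> (\<lambda>_. 0) \<Longrightarrow> 0 < Re (pairing n d p)"
  obtains Q where "Q \<in> pos_polys n N"
    and "\<And>k. \<bar>k\<bar> \<le> int n \<Longrightarrow> grid_moment N (\<lambda>j. grid_value n N P j / grid_value n N Q j) k = d k"
proof -
  let ?a = "grid_value n N P"
  let ?A = "\<Sum>j\<in>grid N. ?a j"
  have a_pos: "0 < ?a j" if "j \<in> grid N" for j
    using P that by (simp add: pos_polys_iff)
  have A_pos: "0 < ?A"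
    using assms(1) a_pos by (intro sum_pos) (auto simp: grid_def)
  obtain Q\<^sub>0 where Q0: "Q\<^sub>0 \<in> pos_polys n N"
    and max: "\<And>p. p \<in> pos_polys n N \<Longrightarrow> log_ratio n N ?a d p \<le> log_ratio n N ?a d Q\<^sub>0"
    using log_ratio_attains_max[OF assms(1), of ?a d] a_pos d_pos by blast
  have "Q\<^sub>0 \<noteq> (\<lambda>_. 0)"
  proof
    assume zero: "Q\<^sub>0 = (\<lambda>_. 0)"
    have "grid_value n N Q\<^sub>0 0 = 0"
      by (simp add: zero grid_value_def trig_eval_def)
    moreover have "0 \<in> grid N"
      using assms(1) by (simp add: grid_def)
    ultimately show False
      using Q0 unfolding pos_polys_iff by (metis less_irrefl)
  qed
  then have L0: "0 < Re (pairing n d Q\<^sub>0)"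
    using Q0 pos_polys_subset_nonneg by (intro d_pos) auto
  \<comment> \<open>The factor that turns the stationarity identity into equality of the pairings.\<close>
  define s where "s = ?A / (real (2 * N) * Re (pairing n d Q\<^sub>0))"
  have s_pos: "0 < s"
    using A_pos L0 assms(1) by (simp add: s_def)
  define Q where "Q = (\<lambda>k. of_real s * Q\<^sub>0 k)"
  have Q_value: "grid_value n N Q j = s * grid_value n N Q\<^sub>0 j" for j
    by (simp add: Q_def grid_value_scale)
  show ?thesis
  proof (rule that[of Q])
    show "Q \<in> pos_polys n N"
      using Q0 s_pos unfolding pos_polys_iff Q_value
      by (auto simp: Q_def sym_trig_polys_scale)
    fix k :: int assume k: "\<bar>k\<bar> \<le> int n"
    show "grid_moment N (\<lambda>j. ?a j / grid_value n N Q j) k = d k"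
    proof (rule pairing_eq_imp_coeff_eq[where d = "grid_moment _ _"])
      fix R assume R: "R \<in> sym_trig_polys n"
      have stationary: "(\<Sum>j\<in>grid N. ?a j * grid_value n N R j / grid_value n N Q\<^sub>0 j)
          = ?A * Re (pairing n d R) / Re (pairing n d Q\<^sub>0)"
        using assms(1) Q0 L0 max R by (intro log_ratio_stationary) auto
      have "Re (pairing n (grid_moment N (\<lambda>j. ?a j / grid_value n N Q j)) R)
          = (\<Sum>j\<in>grid N. ?a j * grid_value n N R j / grid_value n N Q\<^sub>0 j) / (s * real (2 * N))"
        unfolding pairing_grid_moment[OF R] Q_value
        by (simp add: sum_divide_distrib field_simps)
      also have "\<dots> = Re (pairing n d R)"
        unfolding stationary s_def using A_pos L0 assms(1) by (simp add: field_simps)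
      finally show "Re (pairing n (grid_moment N (\<lambda>j. ?a j / grid_value n N Q j)) R)
          = Re (pairing n d R)" .
    qed (use k in \<open>auto simp: grid_moment_uminus sym\<close>)
  qed
qed

theorem theorem1:
  fixes n N :: nat and c :: "nat \<Rightarrow> complex" and P :: "int \<Rightarrow> complex"
  assumes "0 < n" and "n < N"
    and "c \<in> dual_cone n N"
    and "P \<in> pos_polys n N"
  shows "\<exists>!Q. Q \<in> pos_polys n N \<and>
    (\<forall>k\<in>{0..n}. 1 / (2 * of_nat N) *
       (\<Sum>j = - int N + 1..int N.
          zeta N j ^ k * (trig_eval n P (zeta N j) / trig_eval n Q (zeta N j))) = c k)"
proof -
  have c0: "c 0 \<in> \<real>"
    using assms(3) by (simp add: dual_cone_def)
  have c_pos: "0 < Re (pairing n (sym_extend c) p)" if "p \<in> nonneg_polys n N" "p \<noteq> (\<lambda>_. 0)" for p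
    using assms(3) that nonneg_subset_closed_pos_polys[of n N] by (auto simp: dual_cone_def)
  have moments: "(\<forall>k\<in>{0..n}. 1 / (2 * of_nat N) * (\<Sum>j = - int N + 1..int N.
          zeta N j ^ k * (trig_eval n P (zeta N j) / trig_eval n Q (zeta N j))) = c k)
      \<longleftrightarrow> (\<forall>k. \<bar>k\<bar> \<le> int n \<longrightarrow>
          grid_moment N (\<lambda>j. grid_value n N P j / grid_value n N Q j) k = sym_extend c k)"
    if "Q \<in> pos_polys n N" for Q
    using that assms(4) c0 by (intro moment_condition_iff) (auto simp: pos_polys_iff)
  obtain Q where Q: "Q \<in> pos_polys n N" and Q_moments: "\<And>k. \<bar>k\<bar> \<le> int n \<Longrightarrow>
      grid_moment N (\<lambda>j. grid_value n N P j / grid_value n N Q j) k = sym_extend c k"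
    using grid_moment_ratio_surj[OF assms(2,4) sym_extend_uminus[of c, OF c0] c_pos] by metis
  show ?thesis
  proof (rule ex1I[of _ Q], goal_cases)
    case 1
    show ?case
      using Q Q_moments unfolding moments[OF Q] by blast
  next
    case (2 Q')
    then have Q': "Q' \<in> pos_polys n N" by blast
    with 2 have "\<bar>k\<bar> \<le> int n \<Longrightarrow>
        grid_moment N (\<lambda>j. grid_value n N P j / grid_value n N Q' j) k = sym_extend c k" for k
      unfolding moments[OF Q'] by blast
    then show ?case
      using Q_moments by (intro grid_moment_ratio_inj[OF assms(2,4) Q' Q]) simp
  qed
qed

end
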